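(* Let $m\ge2$ be an integer, let $c>0$, and let $a=\frac{m}{m-1}\,c$. Let $M=A\cup B$, where $A$ and $B$ are disjoint sets with $|A|=|B|=m$, and define a symmetric function $d$ on $M\times M$ by $d(x,y)=0$ if $x=y$; $d(x,y)=a$ if $x\ne y$ and both $x,y\in A$ or both $x,y\in B$; and $d(x,y)=c$ if one of $x,y$ is in $A$ and the other is in $B$. Then $d$ is a metric on $M$, and the double-point seminorm $\|\cdot\|_{\mathcal{DP}}$ on $\mathrm{TP}(M)$ is not a norm.
   Context: For a metric space $(M,d)$, $\mathrm{TP}(M)$ is the real vector space of all finitely supported functions $f:M\to\mathbb{R}$ with $\sum_{v\in M}f(v)=0$. The double-point seminorm on $\mathrm{TP}(M)$ is $$\|f\|_{\mathcal{DP}}=\sup_{u,v\in M}\left|\sum_{x\in M}\frac{d(v,x)-d(u,x)}{2}\,f(x)\right|.$$ *)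

theory Defs
  imports "HOL-Analysis.Analysis"
begin

(* Real functions on M are represented as total functions on the ambient type that vanish
   outside M; addition and scaling are pointwise. *)
definition TP :: "'a set \<Rightarrow> ('a \<Rightarrow> real) set" where
  "TP M = {f. {x. f x \<noteq> 0} \<subseteq> M \<and> finite {x. f x \<noteq> 0} \<and> (\<Sum>x | x \<in> M \<and> f x \<noteq> 0. f x) = 0}"

(* The sum runs over the support, since sums over infinite sets are 0 by convention.  On TP M,
   for nonempty M, the supremum is that of a nonempty bounded set of reals. *)
definition dp_seminorm :: "'a set \<Rightarrow> ('a \<Rightarrow> 'a \<Rightarrow> real) \<Rightarrow> ('a \<Rightarrow> real) \<Rightarrow> real" where
  "dp_seminorm M d f =
     (SUP (u, v)\<in>M \<times> M. \<bar>\<Sum>x | x \<in> M \<and> f x \<noteq> 0. (d v x - d u x) / 2 * f x\<bar>)"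

definition seminorm_on :: "('a \<Rightarrow> real) set \<Rightarrow> (('a \<Rightarrow> real) \<Rightarrow> real) \<Rightarrow> bool" where
  "seminorm_on V N \<longleftrightarrow>
     (\<forall>f\<in>V. 0 \<le> N f) \<and>
     (\<forall>r. \<forall>f\<in>V. N (\<lambda>x. r * f x) = \<bar>r\<bar> * N f) \<and>
     (\<forall>f\<in>V. \<forall>g\<in>V. N (\<lambda>x. f x + g x) \<le> N f + N g)"

definition norm_on :: "('a \<Rightarrow> real) set \<Rightarrow> (('a \<Rightarrow> real) \<Rightarrow> real) \<Rightarrow> bool" where
  "norm_on V N \<longleftrightarrow> seminorm_on V N \<and> (\<forall>f\<in>V. N f = 0 \<longrightarrow> f = (\<lambda>x. 0))"

(* The value 0 off the union of A and B is immaterial; Metric_space demands nonnegativity and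
   symmetry on the whole type. *)
definition two_block_dist :: "'a set \<Rightarrow> 'a set \<Rightarrow> real \<Rightarrow> real \<Rightarrow> 'a \<Rightarrow> 'a \<Rightarrow> real" where
  "two_block_dist A B a c x y =
     (if x = y then 0
      else if x \<in> A \<and> y \<in> A \<or> x \<in> B \<and> y \<in> B then a
      else if x \<in> A \<and> y \<in> B \<or> x \<in> B \<and> y \<in> A then c
      else 0)"

lemma dp_sum_eq:
  assumes "finite S" "{x. f x \<noteq> 0} \<subseteq> S" "{x. f x \<noteq> 0} \<subseteq> M"
  shows "(\<Sum>x | x \<in> M \<and> f x \<noteq> 0. h x * f x) = (\<Sum>x\<in>S. h x * (f x :: real))"
  using assms by (intro sum.mono_neutral_left) auto

lemma dp_bdd_above:
  assumes "Metric_space M d" "f \<in> TP M"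
  shows "bdd_above ((\<lambda>(u, v). \<bar>\<Sum>x | x \<in> M \<and> f x \<noteq> 0. (d v x - d u x) / 2 * f x\<bar>) ` (M \<times> M))"
proof -
  interpret Metric_space M d by fact
  let ?S = "{x. x \<in> M \<and> f x \<noteq> 0}"
  have S0: "sum f ?S = 0" using assms by (simp add: TP_def)
  show ?thesis
  proof (cases "?S = {}")
    case True
    then show ?thesis by (intro bdd_aboveI[of _ 0]) (auto simp del: Collect_empty_eq)
  next
    case False
    then obtain p where p: "p \<in> M" by auto
    show ?thesis
    proof (intro bdd_aboveI[of _ "\<Sum>x\<in>?S. d p x * \<bar>f x\<bar>"], clarsimp)
      fix u v assume uv: "u \<in> M" "v \<in> M"
      have "(\<Sum>x\<in>?S. (d v x - d u x) / 2 * f x) =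
            (\<Sum>x\<in>?S. ((d v x - d u x) / 2 - (d v p - d u p) / 2) * f x)"
        using S0 by (simp only: left_diff_distrib[of _ "(d v p - d u p) / 2"] sum_subtractf
            sum_distrib_left[symmetric] mult_zero_right diff_zero)
      also have "\<bar>\<dots>\<bar> \<le> (\<Sum>x\<in>?S. d p x * \<bar>f x\<bar>)"
      proof (rule order_trans[OF sum_abs], rule sum_mono)
        fix x assume x: "x \<in> ?S"
        have "d v x \<le> d v p + d p x" "d v p \<le> d v x + d p x"
             "d u x \<le> d u p + d p x" "d u p \<le> d u x + d p x"
          using triangle[of v p x] triangle[of v x p] triangle[of u p x] triangle[of u x p]
            commute[of x p] uv p x by auto
        then have "\<bar>(d v x - d u x) / 2 - (d v p - d u p) / 2\<bar> \<le> d p x"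
          unfolding abs_le_iff diff_divide_distrib by linarith
        then show "\<bar>((d v x - d u x) / 2 - (d v p - d u p) / 2) * f x\<bar> \<le> d p x * \<bar>f x\<bar>"
          by (simp add: abs_mult mult_right_mono)
      qed
      finally show "\<bar>\<Sum>x | x \<in> M \<and> f x \<noteq> 0. (d v x - d u x) * f x / 2\<bar>
                      \<le> (\<Sum>x | x \<in> M \<and> f x \<noteq> 0. d p x * \<bar>f x\<bar>)" by simp
    qed
  qed
qed

lemma seminorm_on_dp_seminorm:
  assumes d: "Metric_space M d" and ne: "M \<noteq> {}"
  shows "seminorm_on (TP M) (dp_seminorm M d)"
proof -
  define T where "T f w = \<bar>\<Sum>x | x \<in> M \<and> f x \<noteq> 0. (d (snd w) x - d (fst w) x) / 2 * f x\<bar>"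
    for f :: "'a \<Rightarrow> real" and w
  have N: "dp_seminorm M d f = (SUP w\<in>M \<times> M. T f w)" for f
    by (simp add: dp_seminorm_def T_def case_prod_beta)
  have bdd: "bdd_above (T f ` (M \<times> M))" if "f \<in> TP M" for f
    using dp_bdd_above[OF d that] by (simp add: T_def case_prod_beta)
  have ne2: "M \<times> M \<noteq> {}" using ne by auto
  have T0: "0 \<le> T f w" for f w by (simp add: T_def)
  have nonneg: "0 \<le> dp_seminorm M d f" if f: "f \<in> TP M" for f
  proof -
    obtain w where w: "w \<in> M \<times> M" using ne2 by blast
    show ?thesis unfolding N by (rule cSUP_upper2[OF bdd[OF f] w T0])
  qed
  have scale: "dp_seminorm M d (\<lambda>x. r * f x) = \<bar>r\<bar> * dp_seminorm M d f"
    if f: "f \<in> TP M" for r f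
  proof -
    have Tr: "T (\<lambda>x. r * f x) w = \<bar>r\<bar> * T f w" for w
    proof (cases "r = 0")
      case False
      then have "T (\<lambda>x. r * f x) w
          = \<bar>\<Sum>x | x \<in> M \<and> f x \<noteq> 0. r * ((d (snd w) x - d (fst w) x) / 2 * f x)\<bar>"
        by (simp add: T_def algebra_simps)
      then show ?thesis by (simp only: T_def abs_mult sum_distrib_left[symmetric])
    qed (simp add: T_def)
    have "(SUP w\<in>M \<times> M. \<bar>r\<bar> * T f w) = \<bar>r\<bar> * (SUP w\<in>M \<times> M. T f w)"
    proof (cases "r = 0")
      case True
      then show ?thesis using ne2 by simp
    next
      case False
      show ?thesis
      proof (rule antisym)
        show "(SUP w\<in>M \<times> M. \<bar>r\<bar> * T f w) \<le> \<bar>r\<bar> * (SUP w\<in>M \<times> M. T f w)"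
          by (rule cSUP_least[OF ne2], rule mult_left_mono, rule cSUP_upper[OF _ bdd[OF f]]) auto
        have b: "bdd_above ((\<lambda>w. \<bar>r\<bar> * T f w) ` (M \<times> M))"
        proof -
          obtain C where "\<And>w. w \<in> M \<times> M \<Longrightarrow> T f w \<le> C"
            using bdd[OF f] by (auto simp only: bdd_above_def)
          then show ?thesis
            by (intro bdd_aboveI[of _ "\<bar>r\<bar> * C"]) (auto intro!: mult_left_mono)
        qed
        have "(SUP w\<in>M \<times> M. T f w) \<le> (SUP w\<in>M \<times> M. \<bar>r\<bar> * T f w) / \<bar>r\<bar>"
        proof (rule cSUP_least[OF ne2])
          fix w assume "w \<in> M \<times> M"
          then have "\<bar>r\<bar> * T f w \<le> (SUP w\<in>M \<times> M. \<bar>r\<bar> * T f w)"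
            by (rule cSUP_upper[OF _ b])
          then show "T f w \<le> (SUP w\<in>M \<times> M. \<bar>r\<bar> * T f w) / \<bar>r\<bar>"
            using False by (simp add: pos_le_divide_eq mult.commute)
        qed
        then show "\<bar>r\<bar> * (SUP w\<in>M \<times> M. T f w) \<le> (SUP w\<in>M \<times> M. \<bar>r\<bar> * T f w)"
          using False by (simp add: pos_le_divide_eq mult.commute)
      qed
    qed
    then show ?thesis by (simp add: N Tr)
  qed
  have tri: "dp_seminorm M d (\<lambda>x. f x + g x) \<le> dp_seminorm M d f + dp_seminorm M d g"
    if f: "f \<in> TP M" and g: "g \<in> TP M" for f g
    unfolding N
  proof (rule cSUP_least[OF ne2])
    fix w assume w: "w \<in> M \<times> M"
    let ?S = "{x. f x \<noteq> 0} \<union> {x. g x \<noteq> 0}"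
    let ?h = "\<lambda>x. (d (snd w) x - d (fst w) x) / 2"
    have fin: "finite ?S" and sub: "{x. f x \<noteq> 0} \<subseteq> M" "{x. g x \<noteq> 0} \<subseteq> M"
      using f g by (auto simp: TP_def)
    have "T (\<lambda>x. f x + g x) w = \<bar>\<Sum>x\<in>?S. ?h x * (f x + g x)\<bar>"
    proof -
      have "{x. f x + g x \<noteq> 0} \<subseteq> ?S" by auto
      moreover from this have "{x. f x + g x \<noteq> 0} \<subseteq> M" using sub by blast
      ultimately show ?thesis
        unfolding T_def by (intro arg_cong[of _ _ abs] dp_sum_eq fin)
    qed
    also have "\<dots> = \<bar>(\<Sum>x\<in>?S. ?h x * f x) + (\<Sum>x\<in>?S. ?h x * g x)\<bar>"
      by (simp only: distrib_left sum.distrib)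
    also have "\<dots> \<le> \<bar>\<Sum>x\<in>?S. ?h x * f x\<bar> + \<bar>\<Sum>x\<in>?S. ?h x * g x\<bar>"
      by (rule abs_triangle_ineq)
    also have "\<bar>\<Sum>x\<in>?S. ?h x * f x\<bar> = T f w"
      unfolding T_def using fin sub by (subst dp_sum_eq[where S = ?S]) auto
    also have "\<bar>\<Sum>x\<in>?S. ?h x * g x\<bar> = T g w"
      unfolding T_def using fin sub by (subst dp_sum_eq[where S = ?S]) auto
    also have "T f w + T g w \<le> (SUP w\<in>M \<times> M. T f w) + (SUP w\<in>M \<times> M. T g w)"
      by (intro add_mono cSUP_upper[OF w] bdd f g)
    finally show "T (\<lambda>x. f x + g x) w \<le> (SUP w\<in>M \<times> M. T f w) + (SUP w\<in>M \<times> M. T g w)" .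
  qed
  show ?thesis unfolding seminorm_on_def using nonneg scale tri by blast
qed

end

(* Every row of the distance matrix sums to (m - 1) a over the block containing its point and to
   m c over the other block; the choice of a makes these equal.  Hence the nonzero function
   1_A - 1_B is annihilated by every distance function d v.  The triangle inequality
   only needs a \<le> 2 c, which holds since m \<ge> 2. *)
theory Submission
  imports Defs
begin

text \<open>On the union, membership in \<open>A\<close> alone determines the block, so
  \<open>B\<close> drops out of the case distinction. In this form the triangle inequality reduces
  to finitely many cases for the simplifier.\<close>

lemma two_block_dist_eq:
  assumes "A \<inter> B = {}" "x \<in> A \<union> B" "y \<in> A \<union> B"
  shows "two_block_dist A B a c x y = (if x = y then 0 else if x \<in> A \<longleftrightarrow> y \<in> A then a else c)"
  using assms by (auto simp: two_block_dist_def)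

lemma Metric_space_two_block_dist:
  assumes "0 < a" "0 < c" "a \<le> 2 * c" "A \<inter> B = {}"
  shows "Metric_space (A \<union> B) (two_block_dist A B a c)"
proof
  fix x y z
  show "0 \<le> two_block_dist A B a c x y"
    using assms by (simp add: two_block_dist_def)
  show "two_block_dist A B a c x y = two_block_dist A B a c y x"
    by (simp add: two_block_dist_def eq_commute[of y x] conj_commute disj_commute)
  assume x: "x \<in> A \<union> B" and y: "y \<in> A \<union> B"
  then show "two_block_dist A B a c x y = 0 \<longleftrightarrow> x = y"
    using assms by (auto simp: two_block_dist_def)
  assume z: "z \<in> A \<union> B"
  \<comment> \<open>The bound \<open>a \<le> 2 * c\<close> enters when \<open>x\<close> and
    \<open>z\<close> are distinct points of one block and \<open>y\<close> lies in the other. The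
    remaining cases follow from the positivity of \<open>a\<close> and \<open>c\<close>.\<close>
  show "two_block_dist A B a c x z \<le> two_block_dist A B a c x y + two_block_dist A B a c y z"
    unfolding two_block_dist_eq[OF assms(4) x z] two_block_dist_eq[OF assms(4) x y]
      two_block_dist_eq[OF assms(4) y z]
    using assms(1-3) by simp
qed

text \<open>This symmetry transfers the row sums computed for a point of \<open>A\<close> to a point
  of \<open>B\<close>.\<close>

lemma two_block_dist_swap: "two_block_dist A B a c = two_block_dist B A a c"
  by (intro ext) (simp add: two_block_dist_def disj_commute)

lemma sum_two_block_dist_same_block:
  assumes "finite A" "v \<in> A"
  shows "(\<Sum>x\<in>A. two_block_dist A B a c v x) = (real (card A) - 1) * a"
proof -
  \<comment> \<open>Positivity lets the natural number \<open>card A - 1\<close>, the size of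
    \<open>A - {v}\<close>, be cast to \<open>real (card A) - 1\<close>.\<close>
  have "card A > 0"
    using assms by (auto simp: card_gt_0_iff)
  moreover have "(\<Sum>x\<in>A - {v}. two_block_dist A B a c v x) = (\<Sum>x\<in>A - {v}. a)"
    using assms by (intro sum.cong) (auto simp: two_block_dist_def)
  moreover have "two_block_dist A B a c v v = 0"
    by (simp add: two_block_dist_def)
  ultimately show ?thesis
    using assms by (simp add: sum.remove[OF assms] of_nat_diff)
qed

lemma sum_two_block_dist_other_block:
  assumes "A \<inter> B = {}" "v \<in> A"
  shows "(\<Sum>x\<in>B. two_block_dist A B a c v x) = real (card B) * c"
proof -
  have "(\<Sum>x\<in>B. two_block_dist A B a c v x) = (\<Sum>x\<in>B. c)"
    using assms by (intro sum.cong) (auto simp: two_block_dist_def)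
  then show ?thesis by simp
qed

lemma two_block_dist_block_sums_eq:
  assumes "finite A" "finite B" "A \<inter> B = {}" "card A = m" "card B = m"
    and "(real m - 1) * a = real m * c" and "v \<in> A \<union> B"
  shows "(\<Sum>x\<in>A. two_block_dist A B a c v x) = (\<Sum>x\<in>B. two_block_dist A B a c v x)"
proof (cases "v \<in> A")
  case True
  then show ?thesis
    using assms by (simp add: sum_two_block_dist_same_block sum_two_block_dist_other_block)
next
  case False
  then show ?thesis
    using assms sum_two_block_dist_same_block[of B v A a c]
      sum_two_block_dist_other_block[of B A v a c]
    by (simp add: two_block_dist_swap[of B A] Int_commute)
qed

text \<open>Each sum under the supremum is half the difference of the distance sums at
  \<open>v\<close> and \<open>u\<close>, both zero. Nonemptiness of \<open>M\<close> makes the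
  supremum of the constant 0 equal to 0.\<close>

lemma dp_seminorm_eq_0:
  assumes "M \<noteq> {}" and "\<And>v. v \<in> M \<Longrightarrow> (\<Sum>x | x \<in> M \<and> f x \<noteq> 0. d v x * f x) = 0"
  shows "dp_seminorm M d f = 0"
proof -
  have "(\<Sum>x | x \<in> M \<and> f x \<noteq> 0. (d v x - d u x) / 2 * f x) = 0" if "u \<in> M" "v \<in> M" for u v
  proof -
    have "(\<Sum>x | x \<in> M \<and> f x \<noteq> 0. (d v x - d u x) / 2 * f x) =
        ((\<Sum>x | x \<in> M \<and> f x \<noteq> 0. d v x * f x) - (\<Sum>x | x \<in> M \<and> f x \<noteq> 0. d u x * f x)) / 2"
      by (simp add: sum_divide_distrib sum_subtractf left_diff_distrib diff_divide_distrib)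
    then show ?thesis
      using assms(2) that by simp
  qed
  then have "dp_seminorm M d f = (SUP w\<in>M \<times> M. 0)"
    unfolding dp_seminorm_def by (intro SUP_cong) auto
  with assms(1) show ?thesis by simp
qed

theorem mainTheorem8:
  fixes m :: nat and a c :: real and A B M :: "'a set" and d :: "'a \<Rightarrow> 'a \<Rightarrow> real"
  assumes "m \<ge> 2" and "c > 0" and "a = real m / (real m - 1) * c"
    and "A \<inter> B = {}" and "card A = m" and "card B = m" and "M = A \<union> B"
    and "d = two_block_dist A B a c"
  shows "Metric_space M d \<and> \<not> norm_on (TP M) (dp_seminorm M d)"
proof
  have m1: "real m - 1 > 0"
    using assms(1) by simp
  have balance: "(real m - 1) * a = real m * c"
    using m1 assms(3) by simp
  have "a > 0"
    using assms(1-3) m1 by simp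
  \<comment> \<open>After clearing the denominator this is exactly \<open>m \<ge> 2\<close>.\<close>
  moreover have "real m / (real m - 1) \<le> 2"
    using m1 assms(1) by (simp add: pos_divide_le_eq)
  then have "a \<le> 2 * c"
    unfolding assms(3) using assms(2) by (intro mult_right_mono) auto
  ultimately show "Metric_space M d"
    using assms by (simp add: Metric_space_two_block_dist)
  \<comment> \<open>Infinite sets have \<open>card\<close> equal to 0, so \<open>m \<ge> 2\<close>
    forces finiteness.\<close>
  have fin: "finite A" "finite B"
    using assms by (auto intro: card_ge_0_finite)
  have ne: "A \<noteq> {}"
    using assms by auto
  define f where "f x = (indicator A x - indicator B x :: real)" for x
  have supp: "{x. f x \<noteq> 0} = M"
    using assms by (auto simp: f_def indicator_def)
  \<comment> \<open>The weight \<open>h\<close> is kept arbitrary because it is used twice: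
    \<open>h = 1\<close> gives total mass \<open>card A - card B = 0\<close>, hence membership in
    \<open>TP M\<close>, and \<open>h = d v\<close> gives the difference of the two block
    sums.\<close>
  have wsum: "(\<Sum>x | x \<in> M \<and> f x \<noteq> 0. h x * f x) = sum h A - sum h B" for h :: "'a \<Rightarrow> real"
  proof -
    have "{x. x \<in> M \<and> f x \<noteq> 0} = A \<union> B"
      using supp assms by auto
    then have "(\<Sum>x | x \<in> M \<and> f x \<noteq> 0. h x * f x) = (\<Sum>x\<in>A. h x * f x) + (\<Sum>x\<in>B. h x * f x)"
      using fin assms by (simp add: sum.union_disjoint)
    also have "(\<Sum>x\<in>A. h x * f x) = sum h A"
      using assms by (intro sum.cong) (auto simp: f_def indicator_def)
    also have "(\<Sum>x\<in>B. h x * f x) = (\<Sum>x\<in>B. - h x)"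
      using assms by (intro sum.cong) (auto simp: f_def indicator_def)
    finally show ?thesis by (simp add: sum_negf)
  qed
  have "f \<in> TP M"
    using supp fin assms wsum[of "\<lambda>_. 1"] by (simp add: TP_def)
  moreover have "dp_seminorm M d f = 0"
  proof (rule dp_seminorm_eq_0)
    show "M \<noteq> {}"
      using ne assms by simp
    show "(\<Sum>x | x \<in> M \<and> f x \<noteq> 0. d v x * f x) = 0" if "v \<in> M" for v
      unfolding wsum
      using two_block_dist_block_sums_eq[OF fin assms(4-6) balance] that assms(7,8) by simp
  qed
  moreover have "f \<noteq> (\<lambda>x. 0)"
    using supp ne assms by auto
  ultimately show "\<not> norm_on (TP M) (dp_seminorm M d)"
    unfolding norm_on_def by blast
qed

end
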